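(* Let $K\ge 1$, let $\hat y\in\{1,\dots,K\}$ be a fixed label, and let $l_k^{\mathrm{soft}}(\hat y)$, $k=1,\dots,K$, be the soft labels of $\hat y$ (defined in the context). For a vector $f=(f_1,\dots,f_K)$ with $f_k>0$ for all $k$ and $\sum_{k=1}^K f_k=1$ (the output of a Softmax layer), define the hierarchically consistent score $$s(f)=-\sum_{k=1}^{K} l_k^{\mathrm{soft}}(\hat y)\,\log f_k .$$ Then $s$ attains its minimum over all such vectors $f$ at $f$ if and only if $f_k=l_k^{\mathrm{soft}}(\hat y)$ for every $k\in\{1,\dots,K\}$.
   Context: The $K$ classes $\{1,\dots,K\}$ are the leaves of a given finite rooted tree $\mathcal T$ (a taxonomy) of height $h_{\mathcal T}\ge 1$. For leaves $i,j$, $LCA(i,j)$ denotes the height in $\mathcal T$ of the lowest common ancestor of $i$ and $j$ (height of a node = length of a longest downward path from it to a leaf, so $LCA(i,i)=0$), and the normalized distance is $d(i,j)=LCA(i,j)/h_{\mathcal T}$. For a real constant $\beta$, the soft label of $i$ is the vector with entries $$l_k^{\mathrm{soft}}(i)=\frac{\exp(-\beta d(k,i))}{\sum_{j=1}^{K}\exp(-\beta d(j,i))},\qquad k=1,\dots,K.$$ *)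

theory Defs
  imports Complex_Main "Graph_Theory.Arc_Walk"
begin

text \<open>
  Arcs point away from the root. Uniqueness of walks also excludes loops, parallel arcs and
  arcs into the root. The predicate \<open>tree\<close> of the graph library is not suitable here: on
  directed graphs it only requires connectedness and the absence of directed cycles.
\<close>
locale rooted_tree = fin_digraph T for T :: "('a, 'b) pre_digraph" +
  fixes r :: 'a
  assumes root_in_verts: "r \<in> verts T"
    and unique_awalk: "v \<in> verts T \<Longrightarrow> \<exists>!p. awalk r p v"

definition leaves :: "('a, 'b) pre_digraph \<Rightarrow> 'a set" where
  "leaves T = {v \<in> verts T. out_arcs T v = {}}"

definition node_height :: "('a, 'b) pre_digraph \<Rightarrow> 'a \<Rightarrow> nat" where
  "node_height T v = Max {length p | p w. w \<in> leaves T \<and> pre_digraph.awalk T v p w}"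

definition common_ancestor :: "('a, 'b) pre_digraph \<Rightarrow> 'a \<Rightarrow> 'a \<Rightarrow> 'a \<Rightarrow> bool" where
  "common_ancestor T i j w \<longleftrightarrow> w \<rightarrow>\<^sup>*\<^bsub>T\<^esub> i \<and> w \<rightarrow>\<^sup>*\<^bsub>T\<^esub> j"

definition lca :: "('a, 'b) pre_digraph \<Rightarrow> 'a \<Rightarrow> 'a \<Rightarrow> 'a" where
  "lca T i j = (THE w. common_ancestor T i j w \<and>
     (\<forall>u. common_ancestor T i j u \<longrightarrow> u \<rightarrow>\<^sup>*\<^bsub>T\<^esub> w))"

definition lca_height :: "('a, 'b) pre_digraph \<Rightarrow> 'a \<Rightarrow> 'a \<Rightarrow> nat" where
  "lca_height T i j = node_height T (lca T i j)"

definition tree_dist :: "('a, 'b) pre_digraph \<Rightarrow> 'a \<Rightarrow> 'a \<Rightarrow> 'a \<Rightarrow> real" where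
  "tree_dist T r i j = real (lca_height T i j) / real (node_height T r)"

text \<open>
  From here on the leaves are the classes \<open>1, \<dots>, K\<close> themselves, so vertices are natural
  numbers; inner vertices are numbers outside \<open>{1..K}\<close>. A vector of length \<open>K\<close> is a function
  on \<open>nat\<close> of which only the values on \<open>{1..K}\<close> matter.
\<close>
definition soft_label ::
    "(nat, 'b) pre_digraph \<Rightarrow> nat \<Rightarrow> real \<Rightarrow> nat \<Rightarrow> nat \<Rightarrow> nat \<Rightarrow> real" where
  "soft_label T r \<beta> K i k =
     exp (- \<beta> * tree_dist T r k i) / (\<Sum>j=1..K. exp (- \<beta> * tree_dist T r j i))"

definition softmax_outputs :: "nat \<Rightarrow> (nat \<Rightarrow> real) set" where
  "softmax_outputs K = {f. (\<forall>k\<in>{1..K}. f k > 0) \<and> (\<Sum>k=1..K. f k) = 1}"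

definition hier_score ::
    "(nat, 'b) pre_digraph \<Rightarrow> nat \<Rightarrow> real \<Rightarrow> nat \<Rightarrow> nat \<Rightarrow> (nat \<Rightarrow> real) \<Rightarrow> real" where
  "hier_score T r \<beta> K y f = - (\<Sum>k=1..K. soft_label T r \<beta> K y k * ln (f k))"

end

theory Submission
  imports Defs
begin

text \<open>
  The soft labels are themselves a positive vector with sum 1, so this is Gibbs' inequality with
  its equality case. With \<open>ln x \<le> x - 1\<close> at \<open>x = q / p\<close>, the sum of the nonnegative terms
  \<open>q - p - p * ln (q / p)\<close> is the difference between cross entropy and entropy, and each term
  vanishes only for \<open>q = p\<close>.
\<close>

lemma gibbs_term_nonneg:
  fixes p q :: real
  assumes "p > 0" "q > 0"
  shows "p * (ln q - ln p) \<le> q - p"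
proof -
  have "p * ln (q / p) \<le> p * (q / p - 1)"
    using assms by (intro mult_left_mono ln_le_minus_one) auto
  then show ?thesis
    using assms by (simp add: ln_div algebra_simps)
qed

text \<open>By strict concavity, the tangent line \<open>x - 1\<close> meets the graph of
  \<open>ln\<close> only at \<open>x = 1\<close>; dividing the hypothesis by \<open>p\<close> puts
  \<open>x = q / p\<close> on both.\<close>

lemma gibbs_term_eq:
  fixes p q :: real
  assumes "p > 0" "q > 0" "p * (ln q - ln p) = q - p"
  shows "q = p"
proof -
  have "ln (q / p) = q / p - 1"
    using assms by (simp add: ln_div field_simps)
  then have "q / p = 1"
    using assms by (intro ln_eq_minus_one) auto
  then show ?thesis
    using assms by simp
qed

lemma
  fixes p q :: "'a \<Rightarrow> real"
  assumes fin: "finite A"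
    and pos: "\<And>k. k \<in> A \<Longrightarrow> p k > 0" "\<And>k. k \<in> A \<Longrightarrow> q k > 0"
    and sum: "sum p A = sum q A"
  shows gibbs_inequality: "- (\<Sum>k\<in>A. p k * ln (p k)) \<le> - (\<Sum>k\<in>A. p k * ln (q k))"
    and gibbs_equality: "(\<Sum>k\<in>A. p k * ln (p k)) = (\<Sum>k\<in>A. p k * ln (q k)) \<Longrightarrow>
      k \<in> A \<Longrightarrow> q k = p k"
proof -
  define g where "g k = q k - p k - p k * (ln (q k) - ln (p k))" for k
  have nonneg: "g k \<ge> 0" if "k \<in> A" for k
    using gibbs_term_nonneg[of "p k" "q k"] pos that by (simp add: g_def)
  \<comment> \<open>Equal total mass cancels the linear parts \<open>q k - p k\<close>, so the
    defects \<open>g k\<close> add up to the Kullback-Leibler divergence of \<open>q\<close> from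
    \<open>p\<close>.\<close>
  have sum_g: "sum g A = (\<Sum>k\<in>A. p k * ln (p k)) - (\<Sum>k\<in>A. p k * ln (q k))"
    using sum by (simp add: g_def sum_subtractf right_diff_distrib)
  show "- (\<Sum>k\<in>A. p k * ln (p k)) \<le> - (\<Sum>k\<in>A. p k * ln (q k))"
    using sum_nonneg[of A g] nonneg sum_g by simp
  show "q k = p k"
    if "(\<Sum>k\<in>A. p k * ln (p k)) = (\<Sum>k\<in>A. p k * ln (q k))" "k \<in> A"
  proof -
    have "sum g A = 0"
      using sum_g that(1) by simp
    then have "g k = 0"
      using sum_nonneg_eq_0_iff[of A g] fin nonneg that(2) by blast
    then show ?thesis
      using gibbs_term_eq[of "p k" "q k"] pos that by (simp add: g_def)
  qed
qed

text \<open>\<open>K \<ge> 1\<close> keeps the normalizing sum nonempty; an empty one would be 0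
  and, as division by 0 yields 0, so would the label.\<close>

lemma soft_label_pos:
  assumes "K \<ge> 1"
  shows "soft_label T r \<beta> K i k > 0"
  using assms unfolding soft_label_def by (intro divide_pos_pos sum_pos) auto

lemma soft_label_sum:
  assumes "K \<ge> 1"
  shows "(\<Sum>k=1..K. soft_label T r \<beta> K i k) = 1"
proof -
  have "(\<Sum>j=1..K. exp (- \<beta> * tree_dist T r j i)) > 0"
    using assms by (intro sum_pos) auto
  then show ?thesis
    unfolding soft_label_def by (simp flip: sum_divide_distrib)
qed

text \<open>\<open>is_arg_min\<close> includes membership of \<open>f\<close> in
  \<open>softmax_outputs K\<close>. Both membership and score see only the values on
  \<open>{1..K}\<close>, so the minimizer is determined there and arbitrary elsewhere.\<close>

theorem proposition1:
  fixes T :: "(nat, 'b) pre_digraph" and r :: nat and \<beta> :: real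
    and K yhat :: nat and f :: "nat \<Rightarrow> real"
  assumes "rooted_tree T r"
    and "leaves T = {1..K}"
    and "node_height T r \<ge> 1"
    and "K \<ge> 1"
    and "yhat \<in> {1..K}"
  shows "is_arg_min (hier_score T r \<beta> K yhat) (\<lambda>g. g \<in> softmax_outputs K) f
    \<longleftrightarrow> (\<forall>k\<in>{1..K}. f k = soft_label T r \<beta> K yhat k)"
proof -
  define l where "l = soft_label T r \<beta> K yhat"
  have l_pos: "l k > 0" for k
    using soft_label_pos[OF \<open>K \<ge> 1\<close>] by (simp add: l_def)
  have l_sum: "sum l {1..K} = 1"
    using soft_label_sum[OF \<open>K \<ge> 1\<close>] by (simp add: l_def)
  have l_out: "l \<in> softmax_outputs K"
    using l_pos l_sum by (simp add: softmax_outputs_def)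
  have score: "hier_score T r \<beta> K yhat g = - (\<Sum>k=1..K. l k * ln (g k))" for g
    by (simp add: hier_score_def l_def)
  \<comment> \<open>The score of \<open>l\<close> is its own entropy, that of \<open>g\<close> the
    cross entropy of \<open>l\<close> and \<open>g\<close>.\<close>
  have le: "hier_score T r \<beta> K yhat l \<le> hier_score T r \<beta> K yhat g"
    if "g \<in> softmax_outputs K" for g
    unfolding score using that l_pos l_sum
    by (intro gibbs_inequality) (auto simp: softmax_outputs_def)
  show ?thesis
    unfolding l_def[symmetric]
  proof
    assume min: "is_arg_min (hier_score T r \<beta> K yhat) (\<lambda>g. g \<in> softmax_outputs K) f"
    then have f_out: "f \<in> softmax_outputs K"
      and "hier_score T r \<beta> K yhat f \<le> hier_score T r \<beta> K yhat l"
      using l_out by (auto simp: is_arg_min_def not_less)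
    \<comment> \<open>Since \<open>l\<close> is an admissible competitor, minimality of
      \<open>f\<close> gives one inequality and \<open>le\<close> the other: this is the equality
      case.\<close>
    then have "(\<Sum>k=1..K. l k * ln (l k)) = (\<Sum>k=1..K. l k * ln (f k))"
      using le[OF f_out] by (simp add: score)
    moreover have "\<And>k. k \<in> {1..K} \<Longrightarrow> f k > 0" "sum l {1..K} = sum f {1..K}"
      using f_out l_sum by (simp_all add: softmax_outputs_def)
    ultimately show "\<forall>k\<in>{1..K}. f k = l k"
      using gibbs_equality[of "{1..K}" l f] l_pos by blast
  next
    assume eq: "\<forall>k\<in>{1..K}. f k = l k"
    \<comment> \<open>\<open>f\<close> may differ from \<open>l\<close> outside
      \<open>{1..K}\<close>, so admissibility and score are carried over from \<open>l\<close> by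
      congruence on this range.\<close>
    then have "sum f {1..K} = sum l {1..K}"
      by (intro sum.cong) auto
    then have "f \<in> softmax_outputs K"
      using eq l_pos l_sum by (simp add: softmax_outputs_def)
    moreover have "hier_score T r \<beta> K yhat f = hier_score T r \<beta> K yhat l"
      unfolding score using eq by simp
    ultimately show "is_arg_min (hier_score T r \<beta> K yhat) (\<lambda>g. g \<in> softmax_outputs K) f"
      using le by (auto simp: is_arg_min_def not_less)
  qed
qed

end
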